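(* Let $f:\{0,1\}^n\to\{0,1\}$ be a periodic symmetric Boolean function with $I(f)$ intervals. Then $NN(f)\ge I(f)$.
   Context: For $X\in\{0,1\}^n$, $|X|$ is the number of ones in $X$; $d$ is Euclidean distance. $f$ is symmetric if $f(X)$ depends only on $|X|$. The intervals of a symmetric $f$ are the maximal sets of consecutive integers in $\{0,\dots,n\}$ on which $f$ (as a function of $|X|$) is constant, and $I(f)$ is their number. $f$ is periodic if all its intervals have the same length (number of integers), called the period $T$. An NN representation of $f$ is a pair of disjoint finite sets $P,N\subset\mathbb{R}^n$ such that for every $X$ with $f(X)=1$ there is $p\in P$ with $d(X,p)<d(X,q)$ for all $q\in N$, and for every $X$ with $f(X)=0$ there is $q\in N$ with $d(X,q)<d(X,p)$ for all $p\in P$; its size is $|P\cup N|$, and $NN(f)$ is the minimum size of an NN representation of $f$. *)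

theory Defs
  imports "HOL-Analysis.Analysis"
begin

text \<open>
  A point of the Boolean cube is a vector of type \<open>bool ^ 'n\<close>, with \<open>n\<close> rendered as
  \<open>CARD('n)\<close>; a Boolean function is a map \<open>bool ^ 'n \<Rightarrow> bool\<close>, with value 1 read as \<open>True\<close>.
\<close>

definition cube_point :: "bool ^ 'n \<Rightarrow> real ^ 'n" where
  "cube_point X = (\<chi> i. of_bool (X $ i))"

definition weight :: "bool ^ 'n \<Rightarrow> nat" where
  "weight X = card {i. X $ i}"

definition symmetric_bf :: "(bool ^ 'n \<Rightarrow> bool) \<Rightarrow> bool" where
  "symmetric_bf f \<longleftrightarrow> (\<forall>X Y. weight X = weight Y \<longrightarrow> f X = f Y)"

text \<open>
  Constancy of \<open>f\<close> as a function of the weight is expressed directly on cube points; for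
  symmetric \<open>f\<close> the two agree, since every weight in \<open>{0..n}\<close> is attained.
\<close>

definition constant_on_weights :: "(bool ^ 'n \<Rightarrow> bool) \<Rightarrow> nat set \<Rightarrow> bool" where
  "constant_on_weights f S \<longleftrightarrow>
     (\<forall>X Y. weight X \<in> S \<longrightarrow> weight Y \<in> S \<longrightarrow> f X = f Y)"

definition constant_blocks :: "(bool ^ 'n \<Rightarrow> bool) \<Rightarrow> nat set set" where
  "constant_blocks f =
     {{a..b} | a b. a \<le> b \<and> b \<le> CARD('n) \<and> constant_on_weights f {a..b}}"

definition intervals :: "(bool ^ 'n \<Rightarrow> bool) \<Rightarrow> nat set set" where
  "intervals f =
     {S \<in> constant_blocks f. \<forall>S' \<in> constant_blocks f. S \<subseteq> S' \<longrightarrow> S' = S}"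

definition num_intervals :: "(bool ^ 'n \<Rightarrow> bool) \<Rightarrow> nat" where
  "num_intervals f = card (intervals f)"

definition periodic_bf :: "(bool ^ 'n \<Rightarrow> bool) \<Rightarrow> bool" where
  "periodic_bf f \<longleftrightarrow> (\<exists>T. \<forall>S \<in> intervals f. card S = T)"

definition NN_representation ::
  "(bool ^ 'n \<Rightarrow> bool) \<Rightarrow> (real ^ 'n) set \<Rightarrow> (real ^ 'n) set \<Rightarrow> bool" where
  "NN_representation f P N \<longleftrightarrow>
     finite P \<and> finite N \<and> P \<inter> N = {} \<and>
     (\<forall>X. f X \<longrightarrow>
        (\<exists>p \<in> P. \<forall>q \<in> N. dist (cube_point X) p < dist (cube_point X) q)) \<and>
     (\<forall>X. \<not> f X \<longrightarrow>
        (\<exists>q \<in> N. \<forall>p \<in> P. dist (cube_point X) q < dist (cube_point X) p))"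

definition NN :: "(bool ^ 'n \<Rightarrow> bool) \<Rightarrow> nat" where
  "NN f = (LEAST k. \<exists>P N. NN_representation f P N \<and> card (P \<union> N) = k)"

lemma cube_point_eq_iff: "cube_point X = cube_point Y \<longleftrightarrow> X = Y"
  by (auto simp: cube_point_def vec_eq_iff)

text \<open>Every Boolean function has an NN representation, so the minimum is attained.\<close>

lemma NN_representation_exists:
  fixes f :: "bool ^ 'n \<Rightarrow> bool"
  shows "\<exists>P N. NN_representation f P N"
proof (intro exI)
  show "NN_representation f (cube_point ` {X. f X}) (cube_point ` {X. \<not> f X})"
    unfolding NN_representation_def
  proof (intro conjI allI impI)
    fix X assume X: "f X"
    show "\<exists>p \<in> cube_point ` {X. f X}. \<forall>q \<in> cube_point ` {X. \<not> f X}.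
            dist (cube_point X) p < dist (cube_point X) q"
      using X by (intro bexI[of _ "cube_point X"]) (auto simp: cube_point_eq_iff)
  next
    fix X assume X: "\<not> f X"
    show "\<exists>q \<in> cube_point ` {X. \<not> f X}. \<forall>p \<in> cube_point ` {X. f X}.
            dist (cube_point X) q < dist (cube_point X) p"
      using X by (intro bexI[of _ "cube_point X"]) (auto simp: cube_point_eq_iff)
  qed (auto simp: cube_point_eq_iff)
qed

lemma NN_attained: "\<exists>P N. NN_representation f P N \<and> card (P \<union> N) = NN f"
  unfolding NN_def by (rule LeastI_ex) (use NN_representation_exists in blast)

end

theory Submission
  imports Defs
begin

text \<open>
  Squared distances from a cube point \<open>X\<close> to the anchors are, up to the common term \<open>weight X\<close>,
  affine in \<open>X\<close>. Fix a set \<open>S\<close> of \<open>T\<close> coordinates and let \<open>a\<close> be the anchor with the largest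
  coordinate sum over \<open>S\<close>. If \<open>a\<close> decided a point \<open>X\<close> vanishing on \<open>S\<close>, it would still decide the
  point obtained by setting all coordinates in \<open>S\<close> to 1; but this raises the weight by \<open>T\<close>, which
  flips \<open>f\<close>. Hence \<open>a\<close> is redundant on the subcube where \<open>S\<close> vanishes, and each block of \<open>T\<close>
  coordinates costs one anchor.
\<close>

lemma weight_indicator [simp]: "weight (\<chi> i. i \<in> V) = card V"
  by (simp add: weight_def)

lemma weight_le_CARD: "weight (X :: bool ^ 'n) \<le> CARD('n)"
  unfolding weight_def by (rule card_mono) auto

lemma exists_weight:
  assumes "w \<le> CARD('n)"
  shows "\<exists>X :: bool ^ 'n. weight X = w"
proof -
  obtain V :: "'n set" where "card V = w"
    using obtain_subset_with_card_n[OF assms] by metis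
  then have "weight (\<chi> i. i \<in> V) = w" by simp
  then show ?thesis by blast
qed

lemma dist_cube_point_union:
  fixes p :: "real ^ 'n"
  assumes "V \<inter> S = {}"
  shows "(dist (cube_point (\<chi> i. i \<in> V \<union> S)) p)\<^sup>2 =
    (dist (cube_point (\<chi> i. i \<in> V)) p)\<^sup>2 + real (card S) - 2 * (\<Sum>i\<in>S. p $ i)"
proof -
  have sq: "(dist (cube_point (\<chi> i. i \<in> W)) p)\<^sup>2 = (\<Sum>i\<in>UNIV. (of_bool (i \<in> W) - p $ i)\<^sup>2)" for W
    by (simp add: dist_vec_def L2_set_def sum_nonneg dist_real_def cube_point_def)
  have "(of_bool (i \<in> V \<union> S) - p $ i)\<^sup>2 =
      (of_bool (i \<in> V) - p $ i)\<^sup>2 + (if i \<in> S then 1 - 2 * p $ i else 0)" for i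
    using assms by (auto simp: power2_eq_square algebra_simps)
  then have "(dist (cube_point (\<chi> i. i \<in> V \<union> S)) p)\<^sup>2 =
      (dist (cube_point (\<chi> i. i \<in> V)) p)\<^sup>2 + (\<Sum>i\<in>UNIV. if i \<in> S then 1 - 2 * p $ i else 0)"
    by (simp only: sq sum.distrib)
  also have "(\<Sum>i\<in>UNIV. if i \<in> S then 1 - 2 * p $ i else 0) = (\<Sum>i\<in>S. 1 - 2 * p $ i)"
    by (simp add: sum.If_cases)
  finally show ?thesis
    by (simp add: sum_subtractf sum_distrib_left)
qed

lemma nearer_after_union:
  fixes p q :: "real ^ 'n"
  assumes "V \<inter> S = {}"
    and "dist (cube_point (\<chi> i. i \<in> V)) p < dist (cube_point (\<chi> i. i \<in> V)) q"
    and "(\<Sum>i\<in>S. q $ i) \<le> (\<Sum>i\<in>S. p $ i)"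
  shows "dist (cube_point (\<chi> i. i \<in> V \<union> S)) p < dist (cube_point (\<chi> i. i \<in> V \<union> S)) q"
proof (rule power2_less_imp_less)
  have "(dist (cube_point (\<chi> i. i \<in> V)) p)\<^sup>2 < (dist (cube_point (\<chi> i. i \<in> V)) q)\<^sup>2"
    using assms(2) by (intro power_strict_mono) auto
  then show "(dist (cube_point (\<chi> i. i \<in> V \<union> S)) p)\<^sup>2 < (dist (cube_point (\<chi> i. i \<in> V \<union> S)) q)\<^sup>2"
    unfolding dist_cube_point_union[OF assms(1)] using assms(3) by simp
qed simp

text \<open>Here \<open>c\<close> is the label of an anchor, and \<open>U\<close> the set of coordinates not yet fixed to 0.\<close>

lemma card_anchors_gt:
  fixes f :: "bool ^ 'n \<Rightarrow> bool" and A :: "(real ^ 'n) set"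
  assumes flip: "\<And>X Y. weight Y = weight X + T \<Longrightarrow> f Y \<noteq> f X"
    and "finite A"
    and "\<And>V. V \<subseteq> U \<Longrightarrow> \<exists>p\<in>A. c p = f (\<chi> i. i \<in> V) \<and>
      (\<forall>q\<in>A. c q \<noteq> f (\<chi> i. i \<in> V) \<longrightarrow>
        dist (cube_point (\<chi> i. i \<in> V)) p < dist (cube_point (\<chi> i. i \<in> V)) q)"
    and "k * T \<le> card U"
  shows "k < card A"
  using assms(2-)
proof (induction k arbitrary: A U)
  case 0
  then have "A \<noteq> {}" by blast
  with 0 show ?case by (simp add: card_gt_0_iff)
next
  case (Suc k)
  have "T \<le> card U" using Suc.prems(3) by simp
  then obtain S where S: "S \<subseteq> U" "card S = T"
    using obtain_subset_with_card_n by metis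
  have "A \<noteq> {}" using Suc.prems(2) by blast
  with Suc.prems(1) obtain a
    where a: "a \<in> A" and Max: "Max ((\<lambda>q. \<Sum>i\<in>S. q $ i) ` A) = (\<Sum>i\<in>S. a $ i)"
    by (rule obtains_MAX)
  have a_max: "(\<Sum>i\<in>S. q $ i) \<le> (\<Sum>i\<in>S. a $ i)" if "q \<in> A" for q
    unfolding Max[symmetric] using Suc.prems(1) that by (intro Max_ge) auto
  have "k < card (A - {a})"
  proof (rule Suc.IH)
    show "finite (A - {a})" using Suc.prems(1) by simp
    show "k * T \<le> card (U - S)"
      using Suc.prems(3) S by (simp add: card_Diff_subset)
  next
    fix V assume V: "V \<subseteq> U - S"
    let ?X = "\<chi> i. i \<in> V" and ?Y = "\<chi> i. i \<in> V \<union> S"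
    have disj: "V \<inter> S = {}" using V by blast
    obtain p where p: "p \<in> A" "c p = f ?X"
      "\<And>q. q \<in> A \<Longrightarrow> c q \<noteq> f ?X \<Longrightarrow> dist (cube_point ?X) p < dist (cube_point ?X) q"
      using Suc.prems(2)[of V] V by blast
    have fY: "f ?Y \<noteq> f ?X"
      using disj S by (intro flip) (simp only: weight_indicator card_Un_disjoint finite)
    have "p \<noteq> a"
    proof
      assume "p = a"
      obtain q where q: "q \<in> A" "c q = f ?Y"
        "\<And>r. r \<in> A \<Longrightarrow> c r \<noteq> f ?Y \<Longrightarrow> dist (cube_point ?Y) q < dist (cube_point ?Y) r"
        using Suc.prems(2)[of "V \<union> S"] V S by blast
      have "dist (cube_point ?X) a < dist (cube_point ?X) q"
        using p(3) q(1,2) fY \<open>p = a\<close> by auto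
      then have "dist (cube_point ?Y) a < dist (cube_point ?Y) q"
        by (rule nearer_after_union[OF disj _ a_max[OF q(1)]])
      moreover have "dist (cube_point ?Y) q < dist (cube_point ?Y) a"
        using q(3) p(1,2) fY \<open>p = a\<close> by auto
      ultimately show False by simp
    qed
    then show "\<exists>p\<in>A - {a}. c p = f ?X \<and> (\<forall>q\<in>A - {a}. c q \<noteq> f ?X \<longrightarrow>
        dist (cube_point ?X) p < dist (cube_point ?X) q)"
      using p by blast
  qed
  then show ?case using a Suc.prems(1) by simp
qed

lemma NN_representation_nearest_label:
  assumes "NN_representation f P N"
  shows "\<exists>p\<in>P \<union> N. (p \<in> P) = f X \<and>
    (\<forall>q\<in>P \<union> N. (q \<in> P) \<noteq> f X \<longrightarrow> dist (cube_point X) p < dist (cube_point X) q)"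
proof (cases "f X")
  case True
  then obtain p where "p \<in> P" "\<forall>q\<in>N. dist (cube_point X) p < dist (cube_point X) q"
    using assms unfolding NN_representation_def by blast
  with True show ?thesis by (intro bexI[of _ p]) auto
next
  case False
  then obtain q where "q \<in> N" "\<forall>p\<in>P. dist (cube_point X) q < dist (cube_point X) p"
    using assms unfolding NN_representation_def by blast
  with False assms show ?thesis
    unfolding NN_representation_def by (intro bexI[of _ q]) auto
qed

lemma constant_blocks_Un:
  fixes f :: "bool ^ 'n \<Rightarrow> bool"
  assumes "{a..b} \<in> constant_blocks f" "{c..d} \<in> constant_blocks f"
    and w: "w \<in> {a..b}" "w \<in> {c..d}"
  shows "{a..b} \<union> {c..d} \<in> constant_blocks f"
proof -
  have ab: "b \<le> CARD('n)" "constant_on_weights f {a..b}"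
    and cd: "d \<le> CARD('n)" "constant_on_weights f {c..d}"
    using assms by (auto simp: constant_blocks_def Icc_eq_Icc)
  obtain Z :: "bool ^ 'n" where Z: "weight Z = w"
    using exists_weight[of w, where 'n = 'n] w ab by auto
  have "f X = f Z" if "weight X \<in> {a..b} \<union> {c..d}" for X
    using that ab(2) cd(2) w unfolding constant_on_weights_def Z[symmetric] by blast
  then have "constant_on_weights f ({a..b} \<union> {c..d})"
    unfolding constant_on_weights_def by blast
  moreover have "{a..b} \<union> {c..d} = {min a c..max b d}"
    using w by auto
  moreover have "min a c \<le> max b d" "max b d \<le> CARD('n)"
    using w ab(1) cd(1) by auto
  ultimately show ?thesis
    unfolding constant_blocks_def mem_Collect_eq by (metis (no_types))
qed

lemma intervals_E:
  fixes f :: "bool ^ 'n \<Rightarrow> bool"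
  assumes "S \<in> intervals f"
  obtains a b where "S = {a..b}" "a \<le> b" "b \<le> CARD('n)" "constant_on_weights f {a..b}"
  using assms by (auto simp: intervals_def constant_blocks_def)

lemma intervals_eqI:
  assumes "S \<in> intervals f" "S' \<in> intervals f" "w \<in> S" "w \<in> S'"
  shows "S = S'"
proof -
  obtain a b where S: "S = {a..b}" using intervals_E[OF assms(1)] .
  obtain c d where S': "S' = {c..d}" using intervals_E[OF assms(2)] .
  have "S \<in> constant_blocks f" "S' \<in> constant_blocks f"
    using assms(1,2) by (simp_all add: intervals_def)
  then have "S \<union> S' \<in> constant_blocks f"
    using assms(3,4) unfolding S S' by (rule constant_blocks_Un)
  then have "S \<union> S' = S" "S \<union> S' = S'"
    using assms(1,2) unfolding intervals_def by blast+
  then show ?thesis by simp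
qed

lemma finite_constant_blocks: "finite (constant_blocks (f :: bool ^ 'n \<Rightarrow> bool))"
  by (rule finite_subset[of _ "Pow {..CARD('n)}"]) (auto simp: constant_blocks_def)

lemma constant_block_in_interval:
  assumes "B \<in> constant_blocks f"
  obtains S where "S \<in> intervals f" "B \<subseteq> S"
  using finite_has_maximal2[OF finite_constant_blocks assms]
  by (auto simp: intervals_def)

lemma weight_in_interval:
  fixes f :: "bool ^ 'n \<Rightarrow> bool"
  assumes "symmetric_bf f" "w \<le> CARD('n)"
  obtains S where "S \<in> intervals f" "w \<in> S"
proof -
  have "constant_on_weights f {w..w}"
    using assms(1) by (simp add: constant_on_weights_def symmetric_bf_def)
  then have "{w..w} \<in> constant_blocks f"
    using assms(2) unfolding constant_blocks_def by blast
  then obtain S where "S \<in> intervals f" "{w..w} \<subseteq> S"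
    by (rule constant_block_in_interval)
  then show ?thesis using that by simp
qed

lemma periodic_flip:
  fixes f :: "bool ^ 'n \<Rightarrow> bool"
  assumes sym: "symmetric_bf f"
    and T: "\<And>S. S \<in> intervals f \<Longrightarrow> card S = T"
    and XY: "weight Y = weight X + T"
  shows "f Y \<noteq> f X"
proof
  assume eq: "f Y = f X"
  have Yn: "weight X + T \<le> CARD('n)" using XY weight_le_CARD[of Y] by simp
  obtain S where S: "S \<in> intervals f" "weight X \<in> S"
    using weight_in_interval[OF sym weight_le_CARD] .
  obtain a b where ab: "S = {a..b}" "a \<le> b" "constant_on_weights f {a..b}"
    using intervals_E[OF S(1)] .
  have b: "Suc b = a + T" using T[OF S(1)] ab by simp
  have "a + T \<le> CARD('n)" using S(2) ab(1) Yn by simp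
  then obtain S' where S': "S' \<in> intervals f" "a + T \<in> S'"
    using weight_in_interval[OF sym] by blast
  obtain c d where cd: "S' = {c..d}" "c \<le> d" "d \<le> CARD('n)" "constant_on_weights f {c..d}"
    using intervals_E[OF S'(1)] .
  have d: "Suc d = c + T" using T[OF S'(1)] cd by simp
  have "b \<notin> S'"
    using intervals_eqI[OF S(1) S'(1), of b] ab S'(2) b by auto
  then have c: "c = a + T" using S'(2) cd(1) b by auto
  have "weight X \<in> {a..b}" using S(2) ab(1) by simp
  moreover have "weight Y \<in> {c..d}" using S(2) ab(1) b c d XY by auto
  ultimately have "f Z = f X" if "weight Z \<in> {a..b} \<union> {c..d}" for Z
    using that ab(3) cd(4) eq unfolding constant_on_weights_def by blast
  then have "constant_on_weights f ({a..b} \<union> {c..d})"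
    unfolding constant_on_weights_def by blast
  moreover have "{a..b} \<union> {c..d} = {a..d}" using ab(2) cd(2) b c by auto
  ultimately have "{a..d} \<in> constant_blocks f"
    using ab(2) cd(2,3) b c unfolding constant_blocks_def by auto
  moreover have "S \<subseteq> {a..d}" using ab(1) b c cd(2) by auto
  ultimately have "{a..d} = S"
    using S(1) unfolding intervals_def by blast
  then show False using ab(1,2) b c cd(2) by auto
qed

lemma num_intervals_mult_period_le:
  fixes f :: "bool ^ 'n \<Rightarrow> bool"
  assumes T: "\<And>S. S \<in> intervals f \<Longrightarrow> card S = T"
  shows "num_intervals f * T \<le> CARD('n) + 1"
proof -
  have "finite (intervals f)"
    using finite_constant_blocks by (rule finite_subset[rotated]) (auto simp: intervals_def)
  moreover have sub: "S \<subseteq> {..CARD('n)}" if "S \<in> intervals f" for S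
    using that by (auto elim: intervals_E)
  then have "finite S" if "S \<in> intervals f" for S
    using that by (meson finite_atMost finite_subset)
  moreover have "S \<inter> S' = {}" if "S \<in> intervals f" "S' \<in> intervals f" "S \<noteq> S'" for S S'
    using intervals_eqI that by blast
  ultimately have "num_intervals f * T = card (\<Union>(intervals f))"
    using T by (simp add: num_intervals_def card_Union_disjoint pairwise_def disjnt_def)
  also have "\<dots> \<le> card {..CARD('n)}"
    using sub by (intro card_mono) auto
  finally show ?thesis by simp
qed

theorem theorem4:
  fixes f :: "bool ^ 'n \<Rightarrow> bool"
  assumes "symmetric_bf f"
    and "periodic_bf f"
  shows "NN f \<ge> num_intervals f"
proof -
  obtain T where T: "\<And>S. S \<in> intervals f \<Longrightarrow> card S = T"
    using assms(2) unfolding periodic_bf_def by blast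
  obtain S where S: "S \<in> intervals f"
    using weight_in_interval[OF assms(1), of 0] by blast
  have "T \<ge> 1" using S T[OF S] by (auto elim: intervals_E)
  then have blocks: "(num_intervals f - 1) * T \<le> card (UNIV :: 'n set)"
    using num_intervals_mult_period_le[of f, OF T] by (simp add: diff_mult_distrib)
  obtain P N where PN: "NN_representation f P N" "card (P \<union> N) = NN f"
    using NN_attained by blast
  have "num_intervals f - 1 < card (P \<union> N)"
  proof (rule card_anchors_gt)
    show "f Y \<noteq> f X" if "weight Y = weight X + T" for X Y
      using assms(1) T that by (rule periodic_flip)
    show "finite (P \<union> N)" using PN(1) by (simp add: NN_representation_def)
    show "(num_intervals f - 1) * T \<le> card (UNIV :: 'n set)" by (fact blocks)
  qed (rule NN_representation_nearest_label[OF PN(1)])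
  then show ?thesis using PN(2) by simp
qed

end
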